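(* Let $S$ be an $AG^{*}$-groupoid. Then $S$ is a $Bol^{*}$-AG-groupoid, i.e. $a((bc)d)=((ab)c)d$ for all $a,b,c,d\in S$.
   Context: A groupoid is a set $S$ with a binary operation, written as juxtaposition; no associativity or commutativity is assumed. An AG-groupoid is a groupoid $S$ satisfying the left invertive law $(ab)c=(cb)a$ for all $a,b,c\in S$. An $AG^{*}$-groupoid is an AG-groupoid satisfying $(ab)c=b(ac)$ for all $a,b,c\in S$. A $Bol^{*}$-AG-groupoid is an AG-groupoid satisfying $a((bc)d)=((ab)c)d$ for all $a,b,c,d\in S$. *)

theory Defs
  imports Main
begin

(* "Groupoid" in the sense of magma, not of category theory. *)
locale groupoid =
  fixes S :: "'a set" and mult :: "'a \<Rightarrow> 'a \<Rightarrow> 'a" (infixl "\<cdot>" 70)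
  assumes closed: "\<lbrakk>a \<in> S; b \<in> S\<rbrakk> \<Longrightarrow> a \<cdot> b \<in> S"

locale AG_groupoid = groupoid +
  assumes left_invertive:
    "\<lbrakk>a \<in> S; b \<in> S; c \<in> S\<rbrakk> \<Longrightarrow> (a \<cdot> b) \<cdot> c = (c \<cdot> b) \<cdot> a"

locale AG_star_groupoid = AG_groupoid +
  assumes AG_star:
    "\<lbrakk>a \<in> S; b \<in> S; c \<in> S\<rbrakk> \<Longrightarrow> (a \<cdot> b) \<cdot> c = b \<cdot> (a \<cdot> c)"

locale Bol_star_AG_groupoid = AG_groupoid +
  assumes Bol_star:
    "\<lbrakk>a \<in> S; b \<in> S; c \<in> S; d \<in> S\<rbrakk>
      \<Longrightarrow> a \<cdot> ((b \<cdot> c) \<cdot> d) = ((a \<cdot> b) \<cdot> c) \<cdot> d"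

end

theory Submission
  imports Defs
begin

text \<open>The left invertive law swaps the outer factors of
  \<open>(a \<cdot> b) \<cdot> c\<close>, and the AG* law brings its middle factor to the front.
  Together they make right-hand products commute under left multiplication
  (\<open>left_mult_commute\<close>). This turns \<open>b \<cdot> c\<close> into
  \<open>c \<cdot> b\<close>, the order from which left invertivity yields
  \<open>(a \<cdot> b) \<cdot> c\<close>.\<close>

lemma (in AG_star_groupoid) left_mult_commute:
  assumes "x \<in> S" "b \<in> S" "c \<in> S"
  shows "x \<cdot> (b \<cdot> c) = x \<cdot> (c \<cdot> b)"
proof -
  have "x \<cdot> (b \<cdot> c) = (b \<cdot> x) \<cdot> c"
    using assms by (simp add: AG_star)
  also have "\<dots> = (c \<cdot> x) \<cdot> b"
    using assms by (intro left_invertive)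
  also have "\<dots> = x \<cdot> (c \<cdot> b)"
    using assms by (intro AG_star)
  finally show ?thesis .
qed

theorem theorem5:
  fixes S :: "'a set" and mult :: "'a \<Rightarrow> 'a \<Rightarrow> 'a"
  assumes "AG_star_groupoid S mult"
  shows "Bol_star_AG_groupoid S mult"
proof -
  interpret AG_star_groupoid S mult by (fact assms)
  show ?thesis
  proof unfold_locales
    fix a b c d
    assume S: "a \<in> S" "b \<in> S" "c \<in> S" "d \<in> S"
    have "mult a (mult (mult b c) d) = mult (mult (mult b c) a) d"
      using S by (intro AG_star[symmetric] closed)
    \<comment> \<open>Moves \<open>mult b c\<close> to the right of a product, where its factors may
      be swapped; the swap done, the same law moves it back.\<close>
    also have "\<dots> = mult (mult d a) (mult b c)"
      using S by (intro left_invertive closed)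
    also have "\<dots> = mult (mult d a) (mult c b)"
      using S by (intro left_mult_commute closed)
    also have "\<dots> = mult (mult (mult c b) a) d"
      using S by (intro left_invertive closed)
    also have "\<dots> = mult (mult (mult a b) c) d"
      using S by (simp only: left_invertive[of c b a])
    finally show "mult a (mult (mult b c) d) = mult (mult (mult a b) c) d" .
  qed
qed

end
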